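(* Let $(G,\tau)$ be an abelian topological group and $G^\wedge$ its group of continuous characters. The following statements are equivalent: (1) There is at least one group topology $\mu$ on $G$ compatible with the duality $(G,G^\wedge)$ (i.e. $(G,\mu)^\wedge=G^\wedge$) such that $(G,\mu)$ is a $k$-group. (2) $(G,\tau^+)$ is a $k_{\mathbb T}$-group.
   Context: All groups are abelian; $\mathbb T$ is the unit circle in $\mathbb C$. For a topological group $(G,\tau)$, $G^\wedge=(G,\tau)^\wedge$ is the group of continuous homomorphisms $G\to\mathbb T$. $\tau^+=\sigma(G,G^\wedge)$ is the Bohr topology: the weakest topology on $G$ making all elements of $G^\wedge$ continuous. A topological group $(G,\mu)$ is a $k$-group if for every topological group $H$ and every homomorphism $f:G\to H$ such that $f|_K$ is continuous for every compact $K\subseteq G$, $f$ is continuous. It is a $k_{\mathbb T}$-group if every homomorphism $f:G\to\mathbb T$ such that $f|_K$ is continuous for every compact $K\subseteq G$ is continuous. *)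

theory Defs
  imports "HOL-Analysis.Analysis" "HOL-Algebra.Algebra"
begin

(* All groups are abelian.  No separation axiom is part of the notion, and compactness of a
   subset is quasi-compactness (compactin). *)
definition topological_group :: "'a monoid \<Rightarrow> 'a topology \<Rightarrow> bool" where
  "topological_group G T \<longleftrightarrow>
     comm_group G \<and> topspace T = carrier G \<and>
     continuous_map (prod_topology T T) T (\<lambda>(x, y). x \<otimes>\<^bsub>G\<^esub> y) \<and>
     continuous_map T T (\<lambda>x. inv\<^bsub>G\<^esub> x)"

definition circle_group :: "complex monoid" where
  "circle_group = \<lparr>carrier = sphere 0 1, mult = (*), one = 1\<rparr>"

definition circle_topology :: "complex topology" where
  "circle_topology = top_of_set (sphere 0 1)"

(* Characters are only meaningful on the carrier; taking them extensional makes HOL equality of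
   functions agree with equality of characters.  The group operations do not depend on the
   topology, so equality of two duals of G is equality of their sets of characters. *)
definition dual_group :: "'a monoid \<Rightarrow> 'a topology \<Rightarrow> ('a \<Rightarrow> complex) monoid" where
  "dual_group G T =
     \<lparr>carrier = {\<phi> \<in> extensional (carrier G).
                   \<phi> \<in> hom G circle_group \<and> continuous_map T circle_topology \<phi>},
      mult = (\<lambda>\<phi> \<psi>. \<lambda>x\<in>carrier G. \<phi> x \<otimes>\<^bsub>circle_group\<^esub> \<psi> x),
      one = (\<lambda>x\<in>carrier G. \<one>\<^bsub>circle_group\<^esub>)\<rparr>"

definition compatible_with_duality :: "'a monoid \<Rightarrow> 'a topology \<Rightarrow> 'a topology \<Rightarrow> bool" where
  "compatible_with_duality G T M \<longleftrightarrow> dual_group G M = dual_group G T"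

definition bohr_topology :: "'a monoid \<Rightarrow> 'a topology \<Rightarrow> 'a topology" where
  "bohr_topology G T =
     topology_generated_by
       {\<phi> -` U \<inter> carrier G | \<phi> U. \<phi> \<in> carrier (dual_group G T) \<and> openin circle_topology U}"

definition continuous_on_compacts :: "'a topology \<Rightarrow> 'b topology \<Rightarrow> ('a \<Rightarrow> 'b) \<Rightarrow> bool" where
  "continuous_on_compacts T S f \<longleftrightarrow>
     (\<forall>K. compactin T K \<longrightarrow> continuous_map (subtopology T K) S f)"

definition k_T_group :: "'a monoid \<Rightarrow> 'a topology \<Rightarrow> bool" where
  "k_T_group G T \<longleftrightarrow>
     topological_group G T \<and>
     (\<forall>f \<in> hom G circle_group. continuous_on_compacts T circle_topology f \<longrightarrow>
        continuous_map T circle_topology f)"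

(* The definition of a k-group quantifies over all topological groups H, whereas HOL can only
   quantify over those whose elements lie in one fixed type 'h.  For k_group the type 'a of the
   elements of G itself is used; lemma k_group_imp_k_group_wrt shows that this already gives the
   property for topological groups H over every type. *)
definition k_group_wrt :: "'h itself \<Rightarrow> 'a monoid \<Rightarrow> 'a topology \<Rightarrow> bool" where
  "k_group_wrt (_ :: 'h itself) G T \<longleftrightarrow>
     topological_group G T \<and>
     (\<forall>(H :: 'h monoid) S. topological_group H S \<longrightarrow>
        (\<forall>f \<in> hom G H. continuous_on_compacts T S f \<longrightarrow> continuous_map T S f))"

definition k_group :: "'a monoid \<Rightarrow> 'a topology \<Rightarrow> bool" where
  "k_group G T \<longleftrightarrow> k_group_wrt TYPE('a) G T"

lemma topological_group_pullback:
  assumes G: "comm_group G" and H: "topological_group H S" and f: "f \<in> hom G H"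
  shows "topological_group G (pullback_topology (carrier G) f S)" (is "topological_group G ?P")
proof -
  have cH: "comm_group H" and tS: "topspace S = carrier H"
    and mS: "continuous_map (prod_topology S S) S (\<lambda>(x, y). x \<otimes>\<^bsub>H\<^esub> y)"
    and iS: "continuous_map S S (\<lambda>x. inv\<^bsub>H\<^esub> x)"
    using H by (auto simp: topological_group_def)
  interpret group_hom G H f
    using G cH f
    by (simp add: group_hom_def group_hom_axioms_def comm_group.axioms(2))
  have tP: "topspace ?P = carrier G"
    using tS hom_closed by (auto simp: topspace_pullback_topology)
  have fP: "continuous_map ?P S f"
    using continuous_map_pullback[of S S id "carrier G" f] by simp
  have "continuous_map (prod_topology ?P ?P) S
          ((\<lambda>(x, y). x \<otimes>\<^bsub>H\<^esub> y) \<circ> (\<lambda>z. (f (fst z), f (snd z))))"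
    by (rule continuous_map_compose[OF _ mS])
       (auto intro!: continuous_map_pairedI
         continuous_map_compose[OF continuous_map_fst fP, unfolded o_def]
         continuous_map_compose[OF continuous_map_snd fP, unfolded o_def])
  then have "continuous_map (prod_topology ?P ?P) S (f \<circ> (\<lambda>(x, y). x \<otimes>\<^bsub>G\<^esub> y))"
    by (rule continuous_map_eq) (auto simp: tP)
  moreover have "topspace (prod_topology ?P ?P) \<subseteq> (\<lambda>(x, y). x \<otimes>\<^bsub>G\<^esub> y) -` carrier G"
    by (auto simp: tP)
  ultimately have "continuous_map (prod_topology ?P ?P) ?P (\<lambda>(x, y). x \<otimes>\<^bsub>G\<^esub> y)"
    by (rule continuous_map_pullback')
  moreover
  have "continuous_map ?P S ((\<lambda>x. inv\<^bsub>H\<^esub> x) \<circ> f)"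
    by (rule continuous_map_compose[OF fP iS])
  then have "continuous_map ?P S (f \<circ> (\<lambda>x. inv\<^bsub>G\<^esub> x))"
    by (rule continuous_map_eq) (auto simp: tP)
  then have "continuous_map ?P ?P (\<lambda>x. inv\<^bsub>G\<^esub> x)"
    by (rule continuous_map_pullback') (auto simp: tP)
  ultimately show ?thesis
    using G tP by (simp add: topological_group_def)
qed

lemma k_group_imp_k_group_wrt:
  fixes G :: "'a monoid"
  assumes "k_group G T"
  shows "k_group_wrt TYPE('h) G T"
proof -
  have GT: "topological_group G T"
    and k: "\<And>(H :: 'a monoid) S f. \<lbrakk>topological_group H S; f \<in> hom G H;
              continuous_on_compacts T S f\<rbrakk> \<Longrightarrow> continuous_map T S f"
    using assms by (auto simp: k_group_def k_group_wrt_def)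
  have tT: "topspace T = carrier G" using GT by (simp add: topological_group_def)
  have "continuous_map T S f"
    if H: "topological_group (H :: 'h monoid) S" and f: "f \<in> hom G H"
      and c: "continuous_on_compacts T S f" for H S f
  proof -
    let ?P = "pullback_topology (carrier G) f S"
    have P: "topological_group G ?P"
      using topological_group_pullback[OF _ H f] GT by (simp add: topological_group_def)
    have "continuous_on_compacts T ?P (\<lambda>x. x)"
      unfolding continuous_on_compacts_def
    proof (intro allI impI)
      fix K assume "compactin T K"
      then have "continuous_map (subtopology T K) S (f \<circ> (\<lambda>x. x))"
        using c by (simp add: continuous_on_compacts_def o_def)
      then show "continuous_map (subtopology T K) ?P (\<lambda>x. x)"
        by (rule continuous_map_pullback') (auto simp: tT)
    qed
    then have id: "continuous_map T ?P (\<lambda>x. x)"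
      by (intro k[OF P]) (auto simp: hom_def)
    have "continuous_map ?P S f"
      using continuous_map_pullback[of S S id "carrier G" f] by simp
    from continuous_map_compose[OF id this] show ?thesis by (simp add: o_def)
  qed
  then show ?thesis using GT by (auto simp: k_group_wrt_def)
qed

lemma topspace_bohr_topology: "topspace (bohr_topology G T) = carrier G"
  if "topological_group G T"
proof -
  define e :: "'a \<Rightarrow> complex" where "e = (\<lambda>x\<in>carrier G. 1)"
  have G: "comm_group G" and t: "topspace T = carrier G"
    using that by (auto simp: topological_group_def)
  interpret comm_group G by (rule G)
  have "continuous_map T circle_topology (\<lambda>x. 1)"
    by (simp add: circle_topology_def)
  then have "continuous_map T circle_topology e"
    by (rule continuous_map_eq) (auto simp: e_def t)
  then have "e \<in> carrier (dual_group G T)"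
    by (auto simp: e_def dual_group_def hom_def circle_group_def)
  moreover have "e -` sphere 0 1 \<inter> carrier G = carrier G"
    by (auto simp: e_def)
  moreover have "openin circle_topology (sphere 0 1)"
    by (simp add: circle_topology_def)
  ultimately show ?thesis
    unfolding bohr_topology_def topology_generated_by_topspace by blast
qed

lemma continuous_map_bohr_topology:
  assumes "topological_group G T" "\<phi> \<in> carrier (dual_group G T)"
  shows "continuous_map (bohr_topology G T) circle_topology \<phi>"
proof -
  have "\<phi> \<in> carrier G \<rightarrow> topspace circle_topology"
    using assms
    by (auto simp: dual_group_def circle_topology_def circle_group_def hom_def)
  moreover have "openin (bohr_topology G T) (\<phi> -` U \<inter> carrier G)"
    if "openin circle_topology U" for U
    unfolding bohr_topology_def
    by (rule topology_generated_by_Basis) (use that assms in blast)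
  ultimately show ?thesis
    by (auto simp: continuous_map_alt topspace_bohr_topology[OF assms(1)])
qed

lemma bohr_topology_coarsest:
  assumes "topspace S = carrier G"
    and "\<And>\<phi>. \<phi> \<in> carrier (dual_group G T) \<Longrightarrow> continuous_map S circle_topology \<phi>"
    and "openin (bohr_topology G T) U"
  shows "openin S U"
proof -
  have "generate_topology_on
          {\<phi> -` V \<inter> carrier G | \<phi> V. \<phi> \<in> carrier (dual_group G T) \<and> openin circle_topology V} U"
    using assms(3) by (simp add: bohr_topology_def openin_topology_generated_by_iff)
  then show ?thesis
  proof induction
    case (Basis s)
    then show ?case using assms(1,2) by (auto simp: continuous_map_alt)
  qed auto
qed

end

theory Submission
  imports Defs
begin

text \<open>
  Call a group topology on \<open>G\<close> admissible if it is coarser than the Bohr topology on each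
  Bohr-compact set. Suprema of admissible topologies are admissible, so there is a finest one,
  \<open>\<mu>\<close>. Since \<open>\<mu>\<close> refines the Bohr topology, the two agree on Bohr-compact sets, which are
  therefore \<open>\<mu>\<close>-compact; hence the topology pulled back along a homomorphism that is continuous
  on \<open>\<mu>\<close>-compact sets is admissible, and \<open>(G, \<mu>)\<close> is a k-group. The \<open>\<mu>\<close>-continuous characters
  are Bohr-continuous on Bohr-compact sets, so the hypothesis on the Bohr topology makes \<open>\<mu>\<close>
  compatible. Conversely, sets compact for a compatible topology are Bohr-compact.
\<close>

section \<open>Suprema of group topologies\<close>

text \<open>For topologies on one common set this is their join. The empty family yields the empty
  space rather than an indiscrete topology on \<open>G\<close>, so the families used below must be
  non-empty.\<close>

definition sup_topology :: "'a topology set \<Rightarrow> 'a topology" where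
  "sup_topology \<S> = topology_generated_by (\<Union>S\<in>\<S>. {U. openin S U})"

lemma openin_sup_topology: "openin (sup_topology \<S>) U" if "S \<in> \<S>" "openin S U"
  unfolding sup_topology_def by (rule topology_generated_by_Basis) (use that in blast)

lemma topspace_sup_topology: "topspace (sup_topology \<S>) = (\<Union>S\<in>\<S>. topspace S)"
  unfolding sup_topology_def topology_generated_by_topspace
  by (auto intro: openin_subset[THEN subsetD])

lemma continuous_map_into_sup_topology:
  assumes "\<S> \<noteq> {}" "\<And>S. S \<in> \<S> \<Longrightarrow> topspace S = A"
    and "\<And>S. S \<in> \<S> \<Longrightarrow> continuous_map W S f"
  shows "continuous_map W (sup_topology \<S>) f"
  unfolding sup_topology_def
proof (rule continuous_on_generated_topo)
  show "openin W (f -` U \<inter> topspace W)" if "U \<in> (\<Union>S\<in>\<S>. {U. openin S U})" for U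
    using that assms(3) by (auto simp: continuous_map_alt)
  \<comment> \<open>Any single member already shows that the image lies in the underlying set of the
    supremum.\<close>
  obtain S where "S \<in> \<S>" using assms(1) by blast
  then show "f ` topspace W \<subseteq> \<Union> (\<Union>S\<in>\<S>. {U. openin S U})"
    using assms(3)[of S] openin_topspace[of S] by (auto simp: continuous_map_def Pi_iff)
qed

lemma continuous_map_from_finer:
  assumes "continuous_map W Z f" "topspace Y = topspace W" "\<And>U. openin W U \<Longrightarrow> openin Y U"
  shows "continuous_map Y Z f"
  using assms by (auto simp: continuous_map_alt)

lemma continuous_map_id_finer:
  assumes "topspace Y = topspace W" "\<And>U. openin W U \<Longrightarrow> openin Y U"
  shows "continuous_map Y W (\<lambda>x. x)"
  by (rule continuous_map_from_finer[OF _ assms]) auto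

text \<open>Continuity into a supremum is tested one member \<open>S\<close> at a time. For each
  \<open>S\<close>, the operation factors through the identity from the supremum to
  \<open>S\<close>, where it is continuous by hypothesis.\<close>

lemma topological_group_sup_topology:
  assumes "\<S> \<noteq> {}" and gr: "\<And>S. S \<in> \<S> \<Longrightarrow> topological_group G S"
  shows "topological_group G (sup_topology \<S>)"
proof -
  let ?M = "sup_topology \<S>"
  have t: "topspace S = carrier G" if "S \<in> \<S>" for S
    using gr[OF that] by (simp add: topological_group_def)
  have tM: "topspace ?M = carrier G" using assms(1) t by (auto simp: topspace_sup_topology)
  have id: "continuous_map ?M S (\<lambda>x. x)" if "S \<in> \<S>" for S
    by (rule continuous_map_id_finer) (use that t tM in \<open>auto intro: openin_sup_topology\<close>)
  have "continuous_map (prod_topology ?M ?M) S (\<lambda>(x, y). x \<otimes>\<^bsub>G\<^esub> y)" if S: "S \<in> \<S>" for S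
  proof -
    \<comment> \<open>This is the identity on pairs, coarsening the topology in each coordinate from
      \<open>?M\<close> to \<open>S\<close>.\<close>
    have "continuous_map (prod_topology ?M ?M) (prod_topology S S) (\<lambda>z. (fst z, snd z))"
      using continuous_map_compose[OF continuous_map_fst id[OF S]]
        continuous_map_compose[OF continuous_map_snd id[OF S]]
      by (intro continuous_map_pairedI) (auto simp: o_def)
    moreover have "continuous_map (prod_topology S S) S (\<lambda>(x, y). x \<otimes>\<^bsub>G\<^esub> y)"
      using gr[OF S] by (simp add: topological_group_def)
    ultimately show ?thesis
      using continuous_map_compose[of "prod_topology ?M ?M" "prod_topology S S" _ S]
      by (fastforce simp: o_def)
  qed
  moreover have "continuous_map ?M S (\<lambda>x. inv\<^bsub>G\<^esub> x)" if S: "S \<in> \<S>" for S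
    using continuous_map_compose[OF id[OF S]] gr[OF S]
    by (fastforce simp: topological_group_def o_def)
  ultimately show ?thesis
    using assms tM t
    by (auto simp: topological_group_def
        intro!: continuous_map_into_sup_topology[where A = "carrier G"])
qed

section \<open>The circle group and the Bohr topology as a group topology\<close>

lemma cnj_mult_self_circle: "cnj z * z = 1" if "z \<in> sphere 0 1"
  using that complex_norm_square[of z] by (simp add: mult.commute)

lemma comm_group_circle: "comm_group circle_group"
proof (rule comm_groupI)
  show "\<exists>y\<in>carrier circle_group. y \<otimes>\<^bsub>circle_group\<^esub> x = \<one>\<^bsub>circle_group\<^esub>"
    if "x \<in> carrier circle_group" for x
    using that cnj_mult_self_circle[of x]
    by (intro bexI[of _ "cnj x"]) (auto simp: circle_group_def)
qed (auto simp: circle_group_def norm_mult)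

lemma inv_circle_group: "inv\<^bsub>circle_group\<^esub> z = cnj z" if "z \<in> sphere 0 1"
proof -
  interpret comm_group circle_group by (rule comm_group_circle)
  show ?thesis
    by (rule inv_equality) (use that cnj_mult_self_circle in \<open>auto simp: circle_group_def\<close>)
qed

lemma topological_group_circle: "topological_group circle_group circle_topology"
proof -
  have "continuous_map (prod_topology circle_topology circle_topology) circle_topology
          (\<lambda>(x, y). x * y)"
    by (auto simp: circle_topology_def prod_topology_subtopology_eu norm_mult case_prod_beta
        continuous_map_iff_continuous intro!: continuous_intros)
  moreover have "continuous_map circle_topology circle_topology cnj"
    by (auto simp: circle_topology_def continuous_map_iff_continuous intro!: continuous_intros)
  then have "continuous_map circle_topology circle_topology (\<lambda>x. inv\<^bsub>circle_group\<^esub> x)"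
    by (rule continuous_map_eq) (simp add: inv_circle_group circle_topology_def)
  ultimately show ?thesis
    using comm_group_circle
    by (simp add: topological_group_def) (simp add: circle_group_def circle_topology_def)
qed

lemma carrier_dual_group:
  "\<phi> \<in> carrier (dual_group G T) \<longleftrightarrow>
     \<phi> \<in> extensional (carrier G) \<and> \<phi> \<in> hom G circle_group \<and> continuous_map T circle_topology \<phi>"
  by (simp add: dual_group_def)

lemma restrict_in_dual_group:
  assumes "topological_group G T" "f \<in> hom G circle_group" "continuous_map T circle_topology f"
  shows "restrict f (carrier G) \<in> carrier (dual_group G T)"
proof -
  interpret comm_group G using assms(1) by (simp add: topological_group_def)
  have "continuous_map T circle_topology (restrict f (carrier G))"
    by (rule continuous_map_eq[OF assms(3)]) (use assms(1) in \<open>auto simp: topological_group_def\<close>)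
  then show ?thesis
    using assms(2) by (auto simp: carrier_dual_group hom_def)
qed

lemma dual_group_eq_iff:
  "dual_group G S = dual_group G T \<longleftrightarrow> carrier (dual_group G S) = carrier (dual_group G T)"
  by (simp add: dual_group_def)

text \<open>For a fixed character \<phi>, its generating sets are exactly the open sets of the
  pullback along \<phi>. In this form the Bohr topology inherits continuity of the group operations
  from pullbacks and suprema.\<close>

lemma bohr_topology_eq_sup_topology:
  "bohr_topology G T =
     sup_topology ((\<lambda>\<phi>. pullback_topology (carrier G) \<phi> circle_topology) ` carrier (dual_group G T))"
  unfolding bohr_topology_def sup_topology_def
  by (rule arg_cong[of _ _ topology_generated_by]) (simp add: openin_pullback_topology set_eq_iff; blast)

lemma topological_group_bohr_topology:
  assumes "topological_group G T"
  shows "topological_group G (bohr_topology G T)"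
  unfolding bohr_topology_eq_sup_topology
proof (rule topological_group_sup_topology)
  \<comment> \<open>The trivial character makes the family non-empty.\<close>
  have "(\<lambda>x. 1) \<in> hom G circle_group" "continuous_map T circle_topology (\<lambda>x. 1)"
    by (auto simp: hom_def circle_group_def circle_topology_def)
  then have "carrier (dual_group G T) \<noteq> {}"
    using restrict_in_dual_group[OF assms] by fast
  then show "(\<lambda>\<phi>. pullback_topology (carrier G) \<phi> circle_topology) ` carrier (dual_group G T) \<noteq> {}"
    by simp
  have "comm_group G" using assms by (simp add: topological_group_def)
  then show "topological_group G S"
    if "S \<in> (\<lambda>\<phi>. pullback_topology (carrier G) \<phi> circle_topology) ` carrier (dual_group G T)"
    for S
    using that topological_group_pullback[OF _ topological_group_circle]
    by (auto simp: carrier_dual_group)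
qed

lemma openin_bohr_topology_imp_openin:
  assumes "topological_group G T" "openin (bohr_topology G T) U"
  shows "openin T U"
  using assms
  by (auto simp: topological_group_def carrier_dual_group intro: bohr_topology_coarsest)

section \<open>From a compatible k-group topology to the Bohr topology\<close>

lemma compactin_coarser:
  assumes "compactin Y K" "topspace Y = topspace W" "\<And>U. openin W U \<Longrightarrow> openin Y U"
  shows "compactin W K"
  using image_compactin[OF assms(1) continuous_map_id_finer[OF assms(2,3)]] by simp

lemma continuous_map_subtopology_finer:
  assumes "continuous_map (subtopology W K) Z f"
    and "topspace Y = topspace W" "\<And>U. openin W U \<Longrightarrow> openin Y U"
  shows "continuous_map (subtopology Y K) Z f"
  by (rule continuous_map_from_finer[OF assms(1)])
    (use assms(2,3) in \<open>auto simp: openin_subtopology\<close>)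

text \<open>The Bohr topology depends only on the dual, so \<tau> and \<mu> share it and it is
  coarser than \<mu>. Continuity on Bohr-compact sets therefore gives continuity on \<mu>-compact
  sets, hence \<mu>-continuity, hence membership in the common dual.\<close>

lemma k_T_group_bohr_topology:
  assumes \<tau>: "topological_group G \<tau>" and \<mu>: "topological_group G \<mu>"
    and compat: "compatible_with_duality G \<tau> \<mu>" and k: "k_group G \<mu>"
  shows "k_T_group G (bohr_topology G \<tau>)"
proof -
  let ?B = "bohr_topology G \<tau>"
  have dual: "carrier (dual_group G \<mu>) = carrier (dual_group G \<tau>)"
    using compat by (simp add: compatible_with_duality_def)
  have B: "?B = bohr_topology G \<mu>"
    by (simp add: bohr_topology_def dual)
  have tB: "topspace ?B = carrier G" by (rule topspace_bohr_topology[OF \<tau>])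
  have t: "topspace \<mu> = topspace ?B"
    using \<mu> tB by (simp add: topological_group_def)
  have finer: "openin \<mu> U" if "openin ?B U" for U
    using openin_bohr_topology_imp_openin[OF \<mu>] that by (simp add: B)
  have "continuous_map ?B circle_topology f"
    if f: "f \<in> hom G circle_group" and c: "continuous_on_compacts ?B circle_topology f" for f
  proof -
    have "continuous_on_compacts \<mu> circle_topology f"
      unfolding continuous_on_compacts_def
    proof (intro allI impI)
      fix K assume "compactin \<mu> K"
      then have "compactin ?B K" using t finer by (rule compactin_coarser)
      then have "continuous_map (subtopology ?B K) circle_topology f"
        using c by (simp add: continuous_on_compacts_def)
      then show "continuous_map (subtopology \<mu> K) circle_topology f"
        using t finer by (rule continuous_map_subtopology_finer)
    qed
    then have "continuous_map \<mu> circle_topology f"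
      \<comment> \<open>\<open>k_group\<close> tests only groups over the type of \<open>G\<close>;
        the circle lives over \<open>complex\<close>, so the transfer between types is
        needed.\<close>
      using k_group_imp_k_group_wrt[OF k, where 'h = complex] f topological_group_circle
      by (auto simp: k_group_wrt_def)
    \<comment> \<open>Elements of the dual are extensional, so \<open>f\<close> is cut down to the
      carrier and restored afterwards.\<close>
    then have "restrict f (carrier G) \<in> carrier (dual_group G \<tau>)"
      using restrict_in_dual_group[OF \<mu> f] dual by simp
    then have "continuous_map ?B circle_topology (restrict f (carrier G))"
      by (rule continuous_map_bohr_topology[OF \<tau>])
    then show ?thesis
      by (rule continuous_map_eq) (simp add: tB)
  qed
  then show ?thesis
    using topological_group_bohr_topology[OF \<tau>] by (simp add: k_T_group_def)
qed

section \<open>The finest admissible group topology\<close>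

text \<open>The k-group coreflection of \<open>(G, T)\<close>. It is formed for an arbitrary group
  topology \<open>T\<close>; only later is \<open>T\<close> taken to be the Bohr topology.\<close>

definition k_modification :: "'a monoid \<Rightarrow> 'a topology \<Rightarrow> 'a topology" where
  "k_modification G T =
     sup_topology {S. topological_group G S \<and> continuous_on_compacts T S (\<lambda>x. x)}"

context
  fixes G :: "'a monoid" and T :: "'a topology"
  assumes T: "topological_group G T"
begin

text \<open>This makes the family non-empty and its supremum finer than \<open>T\<close>.\<close>

lemma self_admissible: "T \<in> {S. topological_group G S \<and> continuous_on_compacts T S (\<lambda>x. x)}"
  using T by (simp add: continuous_on_compacts_def)

lemma topological_group_k_modification: "topological_group G (k_modification G T)"
  unfolding k_modification_def
  using self_admissible by (intro topological_group_sup_topology) auto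

lemma topspace_k_modification: "topspace (k_modification G T) = topspace T"
  using topological_group_k_modification T by (simp add: topological_group_def)

lemma openin_k_modification: "openin T U \<Longrightarrow> openin (k_modification G T) U"
  unfolding k_modification_def using self_admissible by (rule openin_sup_topology)

text \<open>Admissibility passes to the supremum because, on each compact set, continuity into it is
  tested on the members separately.\<close>

lemma continuous_on_compacts_k_modification:
  "continuous_on_compacts T (k_modification G T) (\<lambda>x. x)"
  unfolding k_modification_def continuous_on_compacts_def
proof (intro allI impI, rule continuous_map_into_sup_topology)
  show "{S. topological_group G S \<and>
      (\<forall>K. compactin T K \<longrightarrow> continuous_map (subtopology T K) S (\<lambda>x. x))} \<noteq> {}"
    using self_admissible unfolding continuous_on_compacts_def by blast
qed (auto simp: topological_group_def)

lemma compactin_k_modification: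
  assumes "compactin T K"
  shows "compactin (k_modification G T) K"
proof -
  have "continuous_map (subtopology T K) (k_modification G T) (\<lambda>x. x)"
    using continuous_on_compacts_k_modification assms by (simp add: continuous_on_compacts_def)
  moreover have "compactin (subtopology T K) K"
    using assms by (simp add: compactin_subtopology)
  ultimately show ?thesis
    using image_compactin[of "subtopology T K" K "k_modification G T" "\<lambda>x. x"] by simp
qed

text \<open>A \<open>T\<close>-compact set \<open>K\<close> is also compact for the modification,
  and the identity on \<open>K\<close> is continuous from the \<open>T\<close>-topology to the
  modified one. So \<open>f\<close> on \<open>K\<close> factors through a map already known to be
  continuous.\<close>

lemma continuous_on_compacts_if_k_modification:
  assumes "continuous_on_compacts (k_modification G T) S f"
  shows "continuous_on_compacts T S f"
  unfolding continuous_on_compacts_def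
proof (intro allI impI)
  fix K assume K: "compactin T K"
  have "continuous_map (subtopology T K) (subtopology (k_modification G T) K) (\<lambda>x. x)"
    using continuous_on_compacts_k_modification K
    by (simp add: continuous_on_compacts_def continuous_map_in_subtopology)
  moreover have "continuous_map (subtopology (k_modification G T) K) S f"
    using assms compactin_k_modification[OF K] by (simp add: continuous_on_compacts_def)
  ultimately show "continuous_map (subtopology T K) S f"
    by (rule continuous_map_compose[unfolded o_def])
qed

text \<open>The pullback of \<open>S\<close> along \<open>f\<close> is a group topology on
  \<open>G\<close> itself, whatever the type of \<open>H\<close>, and it is admissible. It is thus
  one of the topologies in the supremum, and \<open>f\<close> is continuous for it.\<close>

lemma continuous_map_k_modification:
  assumes H: "topological_group H S" and f: "f \<in> hom G H" and c: "continuous_on_compacts T S f"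
  shows "continuous_map (k_modification G T) S f"
proof -
  let ?P = "pullback_topology (carrier G) f S"
  have tT: "topspace T = carrier G" using T by (simp add: topological_group_def)
  have P: "topological_group G ?P"
    using topological_group_pullback[OF _ H f] T by (simp add: topological_group_def)
  have "continuous_on_compacts T ?P (\<lambda>x. x)"
    unfolding continuous_on_compacts_def
  proof (intro allI impI)
    fix K assume "compactin T K"
    then have "continuous_map (subtopology T K) S (f \<circ> (\<lambda>x. x))"
      using c by (simp add: continuous_on_compacts_def o_def)
    then show "continuous_map (subtopology T K) ?P (\<lambda>x. x)"
      by (rule continuous_map_pullback') (auto simp: tT)
  qed
  then have "openin (k_modification G T) U" if "openin ?P U" for U
    unfolding k_modification_def using P that by (intro openin_sup_topology[of ?P]) auto
  moreover have "continuous_map ?P S f"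
    using continuous_map_pullback[of S S id "carrier G" f] by simp
  moreover have "topspace (k_modification G T) = topspace ?P"
    using P tT by (simp add: topspace_k_modification topological_group_def)
  ultimately show ?thesis
    by (blast intro: continuous_map_from_finer)
qed

lemma k_group_k_modification: "k_group G (k_modification G T)"
  unfolding k_group_def k_group_wrt_def
  using topological_group_k_modification continuous_map_k_modification
    continuous_on_compacts_if_k_modification
  by blast

end

section \<open>Compatibility of the modified Bohr topology\<close>

lemma compatible_k_modification_bohr_topology:
  assumes \<tau>: "topological_group G \<tau>" and k: "k_T_group G (bohr_topology G \<tau>)"
  shows "compatible_with_duality G \<tau> (k_modification G (bohr_topology G \<tau>))"
proof -
  let ?B = "bohr_topology G \<tau>" and ?M = "k_modification G (bohr_topology G \<tau>)"
  have B: "topological_group G ?B" using k by (simp add: k_T_group_def)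
  \<comment> \<open>Refining the Bohr topology loses no character of \<tau>.\<close>
  have "continuous_map ?M circle_topology f" if "f \<in> carrier (dual_group G \<tau>)" for f
    using continuous_map_bohr_topology[OF \<tau> that] topspace_k_modification[OF B]
      openin_k_modification[OF B]
    by (rule continuous_map_from_finer)
  \<comment> \<open>No character is gained either: passing from \<open>?M\<close> to
    \<open>?B\<close> on compact sets puts \<open>f\<close> within reach of the hypothesis
    \<open>k\<close>, and \<open>?B\<close> is coarser than \<tau>.\<close>
  moreover have "continuous_map \<tau> circle_topology f"
    if f: "f \<in> hom G circle_group" and c: "continuous_map ?M circle_topology f" for f
  proof -
    have "continuous_on_compacts ?M circle_topology f"
      using c by (simp add: continuous_on_compacts_def continuous_map_from_subtopology)
    then have "continuous_on_compacts ?B circle_topology f"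
      by (rule continuous_on_compacts_if_k_modification[OF B])
    then have "continuous_map ?B circle_topology f"
      using k f by (simp add: k_T_group_def)
    moreover have "topspace \<tau> = topspace ?B"
      using \<tau> B by (simp add: topological_group_def)
    ultimately show ?thesis
      using openin_bohr_topology_imp_openin[OF \<tau>] by (rule continuous_map_from_finer)
  qed
  ultimately show ?thesis
    by (auto simp: compatible_with_duality_def dual_group_eq_iff carrier_dual_group)
qed

theorem theorem3p3:
  fixes G :: "'a monoid" and \<tau> :: "'a topology"
  assumes "topological_group G \<tau>"
  shows "(\<exists>\<mu>. topological_group G \<mu> \<and> compatible_with_duality G \<tau> \<mu> \<and> k_group G \<mu>)
         \<longleftrightarrow> k_T_group G (bohr_topology G \<tau>)"
proof
  assume "\<exists>\<mu>. topological_group G \<mu> \<and> compatible_with_duality G \<tau> \<mu> \<and> k_group G \<mu>"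
  then show "k_T_group G (bohr_topology G \<tau>)"
    using k_T_group_bohr_topology[OF assms] by blast
next
  assume k: "k_T_group G (bohr_topology G \<tau>)"
  then have B: "topological_group G (bohr_topology G \<tau>)" by (simp add: k_T_group_def)
  \<comment> \<open>The witness modifies the Bohr topology, not \<tau>: the hypothesis controls
    characters only through Bohr-compact sets.\<close>
  show "\<exists>\<mu>. topological_group G \<mu> \<and> compatible_with_duality G \<tau> \<mu> \<and> k_group G \<mu>"
    using topological_group_k_modification[OF B] k_group_k_modification[OF B]
      compatible_k_modification_bohr_topology[OF assms k]
    by blast
qed

end
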